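(* Let $K$ be a field, let $\mathcal{C}$ be a finite, non-empty, weakly connected collection of cells in $\mathbb{Z}^2$, and let $\mathfrak{p}$ be a minimal prime of $I_{\mathrm{adj}}(\mathcal{C})\subset S_{\mathcal{C}}=K[x_v\mid v\in V(\mathcal{C})]$. Then there exists an admissible set $W$ of $\mathcal{C}$ such that $\mathfrak{p}=P_W(\mathcal{C})$.
   Context: A cell of $\mathbb{Z}^2$ is a set $C=[a,b]=\{a,b,c,d\}$ with $a=(i,j)$, $b=a+(1,1)$, $c=(i,j+1)$, $d=(i+1,j)$; $a,b$ are its diagonal corners, $c,d$ its anti-diagonal corners, $V(C)=\{a,b,c,d\}$ its vertices, and $\{a,c\},\{c,b\},\{b,d\},\{a,d\}$ its edges. For a set $\mathcal{C}$ of cells, $V(\mathcal{C})=\bigcup_{C\in\mathcal{C}}V(C)$. $\mathcal{C}$ is weakly connected if any two cells of $\mathcal{C}$ can be joined by a sequence of cells of $\mathcal{C}$ in which consecutive cells share an edge or a vertex. $I_{\mathrm{adj}}(\mathcal{C})$ is the ideal of $S_{\mathcal{C}}$ generated by the adjacent $2$-minors $x_ax_b-x_cx_d$, one for each cell of $\mathcal{C}$ (with diagonal corners $a,b$ and anti-diagonal corners $c,d$). Lattice ideal: for a (not necessarily weakly connected, possibly empty) set of cells $\mathcal{D}\subseteq\mathcal{C}$, let $\Lambda_{\mathcal{D}}\subseteq\mathbb{Z}^{V(\mathcal{C})}$ be the subgroup generated by the vectors $\mathbf{v}_a+\mathbf{v}_b-\mathbf{v}_c-\mathbf{v}_d$ for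 all cells of $\mathcal{D}$ (with diagonal corners $a,b$ and anti-diagonal corners $c,d$), where $\mathbf{v}_u$ is the standard basis vector indexed by $u$. Then $L_{\mathcal{D}}=(x^{\mathbf{e}^+}-x^{\mathbf{e}^-}\mid \mathbf{e}\in\Lambda_{\mathcal{D}})\subset S_{\mathcal{C}}$, where $\mathbf{e}^+$ and $\mathbf{e}^-$ are the positive and negative parts of $\mathbf{e}$, so $\mathbf{e}=\mathbf{e}^+-\mathbf{e}^-$ (and $L_\emptyset=0$). A subset $W\subseteq V(\mathcal{C})$ (possibly empty) is an admissible set of $\mathcal{C}$ if for every cell $C\in\mathcal{C}$, either $W\cap C=\emptyset$ or $W\cap C$ contains both endpoints of at least one edge of $C$. For such $W$, put $\mathcal{C}_W=\{C\in\mathcal{C}: C\cap W=\emptyset\}$ and $P_W(\mathcal{C})=(x_w: w\in W)+L_{\mathcal{C}_W}\subset S_{\mathcal{C}}$. *)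

theory Defs
  imports
    "HOL-Library.Poly_Mapping"
    "HOL-Computational_Algebra.Group_Closure"
    "HOL-Algebra.Ideal"
begin

section \<open>Cells of the integer plane\<close>

type_synonym point = "int \<times> int"

text \<open>The corners of the cell with lower left corner \<open>a\<close>: the diagonal corners are \<open>a\<close> and
  \<open>diag_corner a\<close> (the \<open>b\<close> of \<open>[a, b]\<close>), the anti-diagonal ones are \<open>upper_corner a\<close> (\<open>c\<close>) and
  \<open>right_corner a\<close> (\<open>d\<close>).\<close>

definition diag_corner :: "point \<Rightarrow> point"
  where "diag_corner a = (fst a + 1, snd a + 1)"

definition upper_corner :: "point \<Rightarrow> point"
  where "upper_corner a = (fst a, snd a + 1)"

definition right_corner :: "point \<Rightarrow> point"
  where "right_corner a = (fst a + 1, snd a)"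

definition cell :: "point \<Rightarrow> point set"
  where "cell a = {a, diag_corner a, upper_corner a, right_corner a}"

definition is_cell :: "point set \<Rightarrow> bool"
  where "is_cell C \<longleftrightarrow> (\<exists>a. C = cell a)"

text \<open>As a cell is the set of its four corners, \<open>V(C) = C\<close>.\<close>

definition vertices :: "point set set \<Rightarrow> point set"
  where "vertices \<C> = \<Union>\<C>"

definition cell_edges :: "point set \<Rightarrow> point set set"
  where "cell_edges C =
    {e. \<exists>a. C = cell a \<and>
       e \<in> {{a, upper_corner a}, {upper_corner a, diag_corner a},
             {diag_corner a, right_corner a}, {a, right_corner a}}}"

definition share_edge_or_vertex :: "point set \<Rightarrow> point set \<Rightarrow> bool"
  where "share_edge_or_vertex C D \<longleftrightarrow> cell_edges C \<inter> cell_edges D \<noteq> {} \<or> C \<inter> D \<noteq> {}"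

definition weakly_connected :: "point set set \<Rightarrow> bool"
  where "weakly_connected \<C> \<longleftrightarrow>
    (\<forall>C\<in>\<C>. \<forall>D\<in>\<C>.
       (C, D) \<in> {(A, B). A \<in> \<C> \<and> B \<in> \<C> \<and> share_edge_or_vertex A B}\<^sup>*)"


section \<open>Polynomial rings\<close>

text \<open>A polynomial in variables indexed by \<open>'v\<close> is a finitely supported map from monomials
  (exponent vectors \<open>'v \<Rightarrow>\<^sub>0 nat\<close>) to coefficients; the type carries the convolution product.
  The ring \<open>K[x\<^sub>v | v \<in> V]\<close> consists of the polynomials whose monomials only involve variables
  from \<open>V\<close>.\<close>

type_synonym ('v, 'k) mpolynomial = "('v \<Rightarrow>\<^sub>0 nat) \<Rightarrow>\<^sub>0 'k"

definition poly_ring :: "'v set \<Rightarrow> ('v, 'k::field) mpolynomial ring"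
  where "poly_ring V =
    \<lparr>carrier = {p. \<forall>m\<in>Poly_Mapping.keys p. Poly_Mapping.keys m \<subseteq> V},
     mult = (*), one = 1, zero = 0, add = (+)\<rparr>"

definition monomial :: "('v \<Rightarrow>\<^sub>0 nat) \<Rightarrow> ('v, 'k::field) mpolynomial"
  where "monomial u = Poly_Mapping.single u 1"

definition var :: "'v \<Rightarrow> ('v, 'k::field) mpolynomial"
  where "var v = monomial (Poly_Mapping.single v 1)"

lemma cring_poly_ring: "cring (poly_ring V :: ('v, 'k::field) mpolynomial ring)"
proof (rule cringI)
  let ?R = "poly_ring V :: ('v, 'k) mpolynomial ring"
  have uminus: "- p \<in> carrier ?R" if "p \<in> carrier ?R" for p
    using that by (auto simp: poly_ring_def)
  show "abelian_group ?R"
  proof (rule abelian_groupI)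
    fix p q assume "p \<in> carrier ?R" "q \<in> carrier ?R"
    then show "p \<oplus>\<^bsub>?R\<^esub> q \<in> carrier ?R"
      using keys_add[of p q] by (fastforce simp: poly_ring_def)
  next
    fix p assume "p \<in> carrier ?R"
    with uminus show "\<exists>q\<in>carrier ?R. q \<oplus>\<^bsub>?R\<^esub> p = \<zero>\<^bsub>?R\<^esub>"
      by (intro bexI[of _ "- p"]) (auto simp: poly_ring_def)
  qed (auto simp: poly_ring_def ac_simps)
  show "comm_monoid ?R"
  proof (rule comm_monoidI)
    fix p q assume pq: "p \<in> carrier ?R" "q \<in> carrier ?R"
    show "p \<otimes>\<^bsub>?R\<^esub> q \<in> carrier ?R"
    proof -
      have "Poly_Mapping.keys m \<subseteq> V" if m: "m \<in> Poly_Mapping.keys (p * q)" for m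
      proof -
        obtain s t where "m = s + t" "s \<in> Poly_Mapping.keys p" "t \<in> Poly_Mapping.keys q"
          using m keys_mult[of p q] by blast
        then show ?thesis
          using pq keys_add[of s t] by (fastforce simp: poly_ring_def)
      qed
      then show ?thesis by (simp add: poly_ring_def)
    qed
  qed (auto simp: poly_ring_def ac_simps)
qed (auto simp: poly_ring_def algebra_simps)

definition minimal_prime_over ::
  "('a, 'b) ring_scheme \<Rightarrow> 'a set \<Rightarrow> 'a set \<Rightarrow> bool"
  where "minimal_prime_over R I P \<longleftrightarrow>
    primeideal P R \<and> I \<subseteq> P \<and>
    (\<forall>Q. primeideal Q R \<and> I \<subseteq> Q \<and> Q \<subseteq> P \<longrightarrow> Q = P)"


section \<open>The ideals attached to a collection of cells\<close>

definition I_adj :: "point set set \<Rightarrow> (point, 'k::field) mpolynomial set"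
  where "I_adj \<C> = genideal (poly_ring (vertices \<C>))
    {var a * var (diag_corner a) - var (upper_corner a) * var (right_corner a) |a. cell a \<in> \<C>}"

text \<open>Integer vectors are finitely supported maps on all of \<open>\<int>\<^sup>2\<close>; for \<open>\<D> \<subseteq> \<C>\<close>, the elements of
  \<open>cell_lattice \<D>\<close> are supported on \<open>vertices \<C>\<close>.\<close>

definition cell_lattice :: "point set set \<Rightarrow> (point \<Rightarrow>\<^sub>0 int) set"
  where "cell_lattice \<D> = group_closure
    {Poly_Mapping.single a 1 + Poly_Mapping.single (diag_corner a) 1
       - Poly_Mapping.single (upper_corner a) 1 - Poly_Mapping.single (right_corner a) 1
     |a. cell a \<in> \<D>}"

text \<open>\<^const>\<open>nat\<close> sends negative integers to 0.\<close>

definition pos_part :: "('v \<Rightarrow>\<^sub>0 int) \<Rightarrow> 'v \<Rightarrow>\<^sub>0 nat"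
  where "pos_part e = Poly_Mapping.map nat e"

definition neg_part :: "('v \<Rightarrow>\<^sub>0 int) \<Rightarrow> 'v \<Rightarrow>\<^sub>0 nat"
  where "neg_part e = Poly_Mapping.map nat (- e)"

text \<open>The ideal \<open>L\<^sub>\<D>\<close> of the polynomial ring on the vertices of \<open>\<C>\<close>, where \<open>\<D> \<subseteq> \<C>\<close>.\<close>

definition lattice_ideal ::
  "point set set \<Rightarrow> point set set \<Rightarrow> (point, 'k::field) mpolynomial set"
  where "lattice_ideal \<C> \<D> = genideal (poly_ring (vertices \<C>))
    {monomial (pos_part e) - monomial (neg_part e) |e. e \<in> cell_lattice \<D>}"

definition admissible :: "point set set \<Rightarrow> point set \<Rightarrow> bool"
  where "admissible \<C> W \<longleftrightarrow>
    W \<subseteq> vertices \<C> \<and>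
    (\<forall>C\<in>\<C>. W \<inter> C = {} \<or> (\<exists>e\<in>cell_edges C. e \<subseteq> W \<inter> C))"

definition cells_avoiding :: "point set set \<Rightarrow> point set \<Rightarrow> point set set"
  where "cells_avoiding \<C> W = {C \<in> \<C>. C \<inter> W = {}}"

definition P_ideal :: "point set set \<Rightarrow> point set \<Rightarrow> (point, 'k::field) mpolynomial set"
  where "P_ideal \<C> W =
    genideal (poly_ring (vertices \<C>)) (var ` W)
      <+>\<^bsub>poly_ring (vertices \<C>)\<^esub> lattice_ideal \<C> (cells_avoiding \<C> W)"

end

theory Submission
  imports Defs "HOL-Library.Product_Lexorder"
begin

text \<open>Let \<open>W\<close> be the set of vertices whose variables lie in the minimal prime \<open>\<pp>\<close>. The
  adjacent minors force \<open>W\<close> to be admissible, and since the variables outside \<open>W\<close> are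
  nonzerodivisors modulo \<open>\<pp>\<close>, the congruences \<open>x\<^sup>m \<equiv> x\<^sup>n\<close> given by the cells avoiding
  \<open>W\<close> propagate to the whole lattice, so \<open>P\<^sub>W \<subseteq> \<pp>\<close>. By minimality it remains to see that
  \<open>P\<^sub>W\<close> is prime: the lattice of a set of cells has a free quotient, so \<open>P\<^sub>W\<close> is the kernel of
  a homomorphism to a Laurent polynomial ring, which is an integral domain.\<close>


section \<open>Integer vectors and monomials\<close>

lemma lookup_map_zero:
  "f 0 = 0 \<Longrightarrow> Poly_Mapping.lookup (Poly_Mapping.map f p) k = f (Poly_Mapping.lookup p k)"
  by (simp add: map.rep_eq when_def)

lemma lookup_pos_part: "Poly_Mapping.lookup (pos_part e) k = nat (Poly_Mapping.lookup e k)"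
  by (simp add: pos_part_def lookup_map_zero)

lemma lookup_neg_part: "Poly_Mapping.lookup (neg_part e) k = nat (- Poly_Mapping.lookup e k)"
  by (simp add: neg_part_def lookup_map_zero)

text \<open>Exponent vectors are moved into the integers because subtraction of naturals
  truncates.\<close>

definition int_vec :: "('v \<Rightarrow>\<^sub>0 nat) \<Rightarrow> 'v \<Rightarrow>\<^sub>0 int"
  where "int_vec m = Poly_Mapping.map int m"

lemma lookup_int_vec [simp]: "Poly_Mapping.lookup (int_vec m) k = int (Poly_Mapping.lookup m k)"
  by (simp add: int_vec_def lookup_map_zero)

lemma int_vec_zero [simp]: "int_vec 0 = 0"
  by (rule poly_mapping_eqI) simp

lemma int_vec_add: "int_vec (m + n) = int_vec m + int_vec n"
  by (rule poly_mapping_eqI) (simp add: lookup_add)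

lemma int_vec_single [simp]: "int_vec (Poly_Mapping.single v n) = Poly_Mapping.single v (int n)"
  by (rule poly_mapping_eqI) (simp add: lookup_single when_def)

lemma int_vec_pos_part_diff_neg_part: "int_vec (pos_part e) - int_vec (neg_part e) = e"
  by (rule poly_mapping_eqI) (simp add: lookup_minus lookup_pos_part lookup_neg_part)

lemma keys_add_nat: "Poly_Mapping.keys (m + n) = Poly_Mapping.keys m \<union> Poly_Mapping.keys n"
  for m n :: "'v \<Rightarrow>\<^sub>0 nat"
  by (auto simp: in_keys_iff lookup_add)

text \<open>The vector \<open>r\<close> is the componentwise minimum of \<open>m\<close> and
  \<open>n\<close>. Every binomial with exponent difference \<open>e\<close> is thus x^r times the
  binomial formed from the two parts of \<open>e\<close>.\<close>

lemma int_vec_diff_decomp: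
  assumes "int_vec m - int_vec n = e"
  obtains r where "m = pos_part e + r" "n = neg_part e + r"
proof
  have eq: "int (Poly_Mapping.lookup m k) - int (Poly_Mapping.lookup n k) = Poly_Mapping.lookup e k" for k
    using arg_cong[OF assms, of "\<lambda>x. Poly_Mapping.lookup x k"] by (simp add: lookup_minus)
  \<comment> \<open>Truncated subtraction loses nothing: \<open>pos_part e\<close> is at most
    \<open>m\<close> in each coordinate.\<close>
  show "m = pos_part e + (m - pos_part e)"
    by (rule poly_mapping_eqI) (use eq in \<open>simp add: lookup_add lookup_minus lookup_pos_part flip: eq\<close>)
  show "n = neg_part e + (m - pos_part e)"
    by (rule poly_mapping_eqI)
      (simp add: lookup_add lookup_minus lookup_pos_part lookup_neg_part flip: eq)
qed

lemma monomial_add: "monomial (m + n) = monomial m * monomial n"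
  by (simp add: monomial_def mult_single)

lemma monomial_zero [simp]: "monomial 0 = 1"
  by (simp add: monomial_def)

lemma monomial_eq_var_mult:
  assumes "v \<in> Poly_Mapping.keys m"
  shows "monomial m = var v * monomial (m - Poly_Mapping.single v 1)"
proof -
  have "m = Poly_Mapping.single v 1 + (m - Poly_Mapping.single v 1)"
    by (rule poly_mapping_eqI)
      (use assms in \<open>auto simp: lookup_add lookup_minus lookup_single when_def in_keys_iff\<close>)
  then show ?thesis
    by (metis monomial_add var_def)
qed

text \<open>With this rule, identities between additive maps need only be checked on single
  terms.\<close>

lemma poly_mapping_add_induct [case_names zero single add]:
  assumes "P 0" "\<And>k c. P (Poly_Mapping.single k c)" "\<And>f g. P f \<Longrightarrow> P g \<Longrightarrow> P (f + g)"
  shows "P (f :: 'a \<Rightarrow>\<^sub>0 'b::monoid_add)"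
proof (induction f rule: update_induct)
  case (update f a b)
  have "Poly_Mapping.update a b f = Poly_Mapping.single a b + f"
    using update.hyps(1)
    by (intro poly_mapping_eqI) (auto simp: lookup_update lookup_add lookup_single when_def in_keys_iff)
  with assms update.IH show ?case by metis
qed (fact assms)


section \<open>Ideals of the polynomial ring\<close>

lemma poly_ring_simps [simp]:
  "mult (poly_ring V) = (*)" "one (poly_ring V) = 1" "zero (poly_ring V) = 0" "add (poly_ring V) = (+)"
  by (simp_all add: poly_ring_def)

lemma monomial_in_poly_ring [simp]: "monomial m \<in> carrier (poly_ring V) \<longleftrightarrow> Poly_Mapping.keys m \<subseteq> V"
  by (simp add: poly_ring_def monomial_def)

lemma var_in_poly_ring [simp]: "var v \<in> carrier (poly_ring V) \<longleftrightarrow> v \<in> V"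
  by (simp add: var_def)

lemma single_in_poly_ring [simp]:
  "Poly_Mapping.keys m \<subseteq> V \<Longrightarrow> Poly_Mapping.single m c \<in> carrier (poly_ring V)"
  by (simp add: poly_ring_def)

lemma poly_ring_mult:
  "p \<in> carrier (poly_ring V) \<Longrightarrow> q \<in> carrier (poly_ring V) \<Longrightarrow> p * q \<in> carrier (poly_ring V)"
  using monoid.m_closed[OF ring.is_monoid[OF cring.axioms(1)[OF cring_poly_ring]]] by simp

lemma poly_ring_diff:
  "p \<in> carrier (poly_ring V) \<Longrightarrow> q \<in> carrier (poly_ring V) \<Longrightarrow> p - q \<in> carrier (poly_ring V)"
  by (auto simp: poly_ring_def dest!: keys_diff[THEN subsetD])

lemma poly_ring_ideal_add: "ideal I (poly_ring V) \<Longrightarrow> p \<in> I \<Longrightarrow> q \<in> I \<Longrightarrow> p + q \<in> I"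
  using additive_subgroup.a_closed[OF ideal.axioms(1), of I "poly_ring V"] by simp

lemma poly_ring_ideal_mult:
  "ideal I (poly_ring V) \<Longrightarrow> p \<in> I \<Longrightarrow> r \<in> carrier (poly_ring V) \<Longrightarrow> r * p \<in> I"
  using ideal.I_l_closed[of I "poly_ring V"] by simp

lemma poly_ring_ideal_zero: "ideal I (poly_ring V) \<Longrightarrow> 0 \<in> I"
  using additive_subgroup.zero_closed[OF ideal.axioms(1), of I "poly_ring V"] by simp

lemma poly_ring_ideal_diff:
  fixes p q :: "('v, 'k::field) mpolynomial"
  assumes "ideal I (poly_ring V)" "p \<in> I" "q \<in> I"
  shows "p - q \<in> I"
proof -
  have "-1 \<in> carrier (poly_ring V :: ('v, 'k) mpolynomial ring)"
    by (simp add: poly_ring_def)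
  with assms have "p + -1 * q \<in> I"
    by (intro poly_ring_ideal_add poly_ring_ideal_mult)
  then show ?thesis by simp
qed

lemma poly_ring_idealI:
  fixes I :: "('v, 'k::field) mpolynomial set"
  assumes "I \<subseteq> carrier (poly_ring V)" "0 \<in> I" "\<And>p q. p \<in> I \<Longrightarrow> q \<in> I \<Longrightarrow> p + q \<in> I"
    and mult: "\<And>p r. p \<in> I \<Longrightarrow> r \<in> carrier (poly_ring V) \<Longrightarrow> r * p \<in> I"
  shows "ideal I (poly_ring V)"
proof (rule idealI)
  interpret cring "poly_ring V :: ('v, 'k) mpolynomial ring" by (rule cring_poly_ring)
  show "ring (poly_ring V :: ('v, 'k) mpolynomial ring)" by (rule ring_axioms)
  show "subgroup I (add_monoid (poly_ring V))"
  proof (rule add.subgroupI)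
    fix p assume p: "p \<in> I"
    \<comment> \<open>Negation is multiplication by the constant -1, so the closure assumptions
      cover it.\<close>
    have "-1 \<in> carrier (poly_ring V :: ('v, 'k) mpolynomial ring)"
      by (simp add: poly_ring_def)
    with mult[OF p this] have "-p \<in> I" by simp
    moreover have "\<ominus>\<^bsub>poly_ring V\<^esub> p = -p"
      using p assms(1) \<open>-p \<in> I\<close> by (intro minus_equality) auto
    ultimately show "\<ominus>\<^bsub>poly_ring V\<^esub> p \<in> I" by simp
  qed (use assms in auto)
qed (use assms in \<open>auto simp: mult.commute\<close>)

text \<open>Induction on the total degree: splitting off one variable leaves a product of two
  elements outside the prime, and 1 lies outside because a prime ideal is proper.\<close>

lemma monomial_notin_prime:
  fixes P :: "('v, 'k::field) mpolynomial set"
  assumes P: "primeideal P (poly_ring V)"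
    and m: "Poly_Mapping.keys m \<subseteq> V" "\<And>v. v \<in> Poly_Mapping.keys m \<Longrightarrow> var v \<notin> P"
  shows "monomial m \<notin> P"
proof -
  interpret primeideal P "poly_ring V" by (rule P)
  have "1 \<notin> P"
    using I_notcarr one_imp_carrier by auto
  from m show ?thesis
  proof (induction "\<Sum>v\<in>Poly_Mapping.keys m. Poly_Mapping.lookup m v" arbitrary: m rule: less_induct)
    case less
    show ?case
    proof (cases "m = 0")
      case False
      then obtain v where v: "v \<in> Poly_Mapping.keys m" by (metis ex_in_conv keys_eq_empty)
      define n where "n = m - Poly_Mapping.single v 1"
      have n: "Poly_Mapping.lookup n u = Poly_Mapping.lookup m u - (if u = v then 1 else 0)" for u
        by (simp add: n_def lookup_minus lookup_single when_def)
      have sub: "Poly_Mapping.keys n \<subseteq> Poly_Mapping.keys m" by (auto simp: in_keys_iff n)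
      \<comment> \<open>Both degrees are summed over the keys of \<open>m\<close>, so that they
        compare term by term; the extra exponents of \<open>n\<close> are 0.\<close>
      have "(\<Sum>u\<in>Poly_Mapping.keys n. Poly_Mapping.lookup n u) = (\<Sum>u\<in>Poly_Mapping.keys m. Poly_Mapping.lookup n u)"
        using sub by (intro sum.mono_neutral_left) (auto simp: in_keys_iff)
      also have "\<dots> < (\<Sum>u\<in>Poly_Mapping.keys m. Poly_Mapping.lookup m u)"
        using v by (intro sum_strict_mono_ex1) (auto simp: n in_keys_iff intro!: bexI[of _ v])
      finally have "monomial n \<notin> P"
        using sub less.prems by (intro less.hyps) auto
      with v less.prems sub have "var v * monomial n \<notin> P"
        using I_prime[of "var v" "monomial n"] by auto
      then show ?thesis by (simp only: monomial_eq_var_mult[OF v] n_def not_False_eq_True)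
    qed (use \<open>1 \<notin> P\<close> in simp)
  qed
qed


section \<open>Toric homomorphisms\<close>

text \<open>The target is the monoid algebra of \<open>'g\<close>. For additive \<Phi> the map is
  multiplicative: it sets the variables of \<open>W\<close> to 0 and sends each remaining x^m to the
  basis element t^(\<Phi> m).\<close>

definition toric_hom ::
  "'v set \<Rightarrow> (('v \<Rightarrow>\<^sub>0 nat) \<Rightarrow> 'g) \<Rightarrow> ('v, 'k::field) mpolynomial \<Rightarrow> 'g \<Rightarrow>\<^sub>0 'k"
  where "toric_hom W \<Phi> f = (\<Sum>m\<in>Poly_Mapping.keys f.
     if Poly_Mapping.keys m \<inter> W = {} then Poly_Mapping.single (\<Phi> m) (Poly_Mapping.lookup f m) else 0)"

lemma toric_hom_single:
  "toric_hom W \<Phi> (Poly_Mapping.single m c) =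
    (if Poly_Mapping.keys m \<inter> W = {} then Poly_Mapping.single (\<Phi> m) c else 0)"
  by (simp add: toric_hom_def)

lemma toric_hom_zero [simp]: "toric_hom W \<Phi> 0 = 0"
  by (simp add: toric_hom_def)

lemma toric_hom_add: "toric_hom W \<Phi> (f + g) = toric_hom W \<Phi> f + toric_hom W \<Phi> g"
  unfolding toric_hom_def
  by (rule setsum_keys_plus_distrib) (auto simp: single_add)

lemma toric_hom_diff: "toric_hom W \<Phi> (f - g) = toric_hom W \<Phi> f - toric_hom W \<Phi> g"
  by (metis add_diff_cancel diff_add_cancel toric_hom_add)

text \<open>Both sides are additive in each factor, so single terms suffice; there a product of
  monomials avoids \<open>W\<close> exactly when both factors do.\<close>

lemma toric_hom_mult:
  fixes \<Phi> :: "('v \<Rightarrow>\<^sub>0 nat) \<Rightarrow> 'g::comm_monoid_add"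
  assumes "\<And>m n. \<Phi> (m + n) = \<Phi> m + \<Phi> n"
  shows "toric_hom W \<Phi> (f * g) = toric_hom W \<Phi> f * toric_hom W \<Phi> g"
proof (induction f rule: poly_mapping_add_induct)
  case (single m c)
  show ?case
  proof (induction g rule: poly_mapping_add_induct)
    case (single n d)
    then show ?case
      by (auto simp: mult_single toric_hom_single keys_add_nat assms Int_Un_distrib2)
  qed (simp_all add: toric_hom_add distrib_left)
qed (simp_all add: toric_hom_add distrib_right)

text \<open>Terms divisible by a variable in \<open>W\<close> can be removed one at a time; any other term \<open>c x\<^sup>m\<close> of
  an element of the kernel must cancel against some \<open>x\<^sup>n\<close> with \<open>\<Phi> n = \<Phi> m\<close>, so subtracting
  \<open>c (x\<^sup>m - x\<^sup>n)\<close> lowers the number of terms.\<close>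

lemma toric_hom_kernel_subset:
  fixes J :: "('v, 'k::field) mpolynomial set"
  assumes J: "ideal J (poly_ring V)" and W: "\<And>w. w \<in> W \<Longrightarrow> var w \<in> J"
    and bin: "\<And>m n. Poly_Mapping.keys m \<subseteq> V \<Longrightarrow> Poly_Mapping.keys n \<subseteq> V \<Longrightarrow> \<Phi> m = \<Phi> n \<Longrightarrow>
                monomial m - monomial n \<in> J"
    and f: "f \<in> carrier (poly_ring V)" "toric_hom W \<Phi> f = 0"
  shows "f \<in> J"
  using f
proof (induction "card (Poly_Mapping.keys f)" arbitrary: f rule: less_induct)
  case less
  \<comment> \<open>Such an \<open>h\<close> brings in no new monomial and cancels the term at
    \<open>m\<close>, so \<open>f - h\<close> has fewer terms.\<close>
  have smaller: "f - h \<in> J"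
    if "toric_hom W \<Phi> h = 0" "h \<in> carrier (poly_ring V)" "m \<in> Poly_Mapping.keys f"
      "Poly_Mapping.lookup h m = Poly_Mapping.lookup f m" "Poly_Mapping.keys h \<subseteq> Poly_Mapping.keys f"
    for h m
  proof (rule less.hyps)
    have "m \<notin> Poly_Mapping.keys (f - h)" using that(4) by (simp add: in_keys_iff lookup_minus)
    then have "Poly_Mapping.keys (f - h) \<subset> Poly_Mapping.keys f"
      using that(3,5) keys_diff[of f h] by blast
    then show "card (Poly_Mapping.keys (f - h)) < card (Poly_Mapping.keys f)"
      by (intro psubset_card_mono) auto
  qed (use that less.prems in \<open>auto simp: toric_hom_diff poly_ring_diff\<close>)
  show ?case
  proof (cases "f = 0")
    case True
    then show ?thesis using J by (simp add: poly_ring_ideal_zero)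
  next
    case False
    then obtain m where m: "m \<in> Poly_Mapping.keys f" by (metis ex_in_conv keys_eq_empty)
    define c where "c = Poly_Mapping.lookup f m"
    have mV: "Poly_Mapping.keys m \<subseteq> V" using m less.prems(1) by (auto simp: poly_ring_def)
    have scale: "Poly_Mapping.single 0 c * p \<in> J" if "p \<in> J" for p
      using J that by (intro poly_ring_ideal_mult) auto
    have "\<exists>h\<in>J. toric_hom W \<Phi> h = 0 \<and> Poly_Mapping.lookup h m = c \<and> Poly_Mapping.keys h \<subseteq> Poly_Mapping.keys f"
    proof (cases "Poly_Mapping.keys m \<inter> W = {}")
      case False
      then obtain w where w: "w \<in> Poly_Mapping.keys m" "w \<in> W" by auto
      have "Poly_Mapping.keys (m - Poly_Mapping.single w 1) \<subseteq> V"
        using mV by (auto simp: in_keys_iff lookup_minus)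
      then have "monomial (m - Poly_Mapping.single w 1) * var w \<in> J"
        using J W w(2) by (intro poly_ring_ideal_mult) auto
      then have "monomial m \<in> J" by (simp add: monomial_eq_var_mult[OF w(1)] mult.commute)
      then have "Poly_Mapping.single m c \<in> J"
        using scale[of "monomial m"] by (simp add: monomial_def mult_single)
      with False m show ?thesis
        by (intro bexI[of _ "Poly_Mapping.single m c"]) (auto simp: toric_hom_single)
    next
      case True
      have "\<exists>n\<in>Poly_Mapping.keys f. n \<noteq> m \<and> Poly_Mapping.keys n \<inter> W = {} \<and> \<Phi> n = \<Phi> m"
      proof (rule ccontr)
        assume none: "\<not> ?thesis"
        \<comment> \<open>Without a partner \<open>n\<close>, the coefficient of the image at
          \<open>\<Phi> m\<close> would be \<open>c\<close> alone, which is nonzero.\<close>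
        have "0 = Poly_Mapping.lookup (toric_hom W \<Phi> f) (\<Phi> m)" by (simp add: less.prems)
        also have "\<dots> = (\<Sum>n\<in>Poly_Mapping.keys f. if n = m then c else 0)"
          unfolding toric_hom_def lookup_sum
          by (intro sum.cong) (use none True in \<open>auto simp: lookup_single when_def c_def\<close>)
        also have "\<dots> = c" using m by simp
        finally show False using m by (simp add: c_def in_keys_iff)
      qed
      then obtain n where n: "n \<in> Poly_Mapping.keys f" "n \<noteq> m" "Poly_Mapping.keys n \<inter> W = {}" "\<Phi> n = \<Phi> m"
        by blast
      have nV: "Poly_Mapping.keys n \<subseteq> V" using n less.prems(1) by (auto simp: poly_ring_def)
      let ?h = "Poly_Mapping.single m c - Poly_Mapping.single n c"
      have "?h = Poly_Mapping.single 0 c * (monomial m - monomial n)"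
        by (simp add: monomial_def right_diff_distrib mult_single)
      then have "?h \<in> J" using scale bin[OF mV nV] n by simp
      moreover have "Poly_Mapping.keys ?h \<subseteq> Poly_Mapping.keys f"
        using keys_diff[of "Poly_Mapping.single m c" "Poly_Mapping.single n c"] m n
        by (auto split: if_splits)
      ultimately show ?thesis using n True
        by (intro bexI[of _ ?h]) (auto simp: toric_hom_diff toric_hom_single lookup_minus lookup_single when_def)
    qed
    then obtain h where h: "h \<in> J" "toric_hom W \<Phi> h = 0" "Poly_Mapping.lookup h m = c"
      "Poly_Mapping.keys h \<subseteq> Poly_Mapping.keys f" by blast
    have "h \<in> carrier (poly_ring V)" using less.prems(1) h(4) by (auto simp: poly_ring_def)
    with h m have "f - h \<in> J" by (intro smaller) (auto simp: c_def)
    with h(1) have "(f - h) + h \<in> J" using J by (intro poly_ring_ideal_add)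
    then show ?thesis by simp
  qed
qed

text \<open>Since \<open>'g\<close> is cancellative and linearly ordered, its algebra over a field
  has no zero divisors, so the kernel of a multiplicative map into it is prime.\<close>

lemma primeideal_toric_hom_kernel:
  fixes \<Phi> :: "('v \<Rightarrow>\<^sub>0 nat) \<Rightarrow> 'g::{ordered_cancel_comm_monoid_add, linorder}"
  assumes add: "\<And>m n. \<Phi> (m + n) = \<Phi> m + \<Phi> n"
  shows "primeideal {f \<in> carrier (poly_ring V). toric_hom W \<Phi> f = (0 :: 'g \<Rightarrow>\<^sub>0 'k::field)} (poly_ring V)"
    (is "primeideal ?P _")
proof (rule primeidealI)
  interpret cring "poly_ring V :: ('v, 'k) mpolynomial ring" by (rule cring_poly_ring)
  show "cring (poly_ring V :: ('v, 'k) mpolynomial ring)" by (rule cring_poly_ring)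
  show "ideal ?P (poly_ring V)"
    using a_closed zero_closed
    by (intro poly_ring_idealI) (auto simp: toric_hom_add toric_hom_mult[OF add] poly_ring_mult)
  \<comment> \<open>The kernel is proper: the constant 1, written as a \<open>single\<close> so that
    \<open>toric_hom_single\<close> applies, goes to a basis element.\<close>
  have "toric_hom W \<Phi> (Poly_Mapping.single 0 1) \<noteq> (0 :: 'g \<Rightarrow>\<^sub>0 'k)"
    by (simp add: toric_hom_single del: single_one) (metis keys_single keys_zero insert_not_empty zero_neq_one)
  then show "carrier (poly_ring V) \<noteq> ?P" using one_closed by auto
qed (auto simp: toric_hom_mult[OF add])


section \<open>The lattice of a collection of cells\<close>

definition cell_vec :: "point \<Rightarrow> point \<Rightarrow>\<^sub>0 int"
  where "cell_vec a = Poly_Mapping.single a 1 + Poly_Mapping.single (diag_corner a) 1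
       - Poly_Mapping.single (upper_corner a) 1 - Poly_Mapping.single (right_corner a) 1"

lemmas corner_defs = diag_corner_def upper_corner_def right_corner_def

lemma cell_lattice_eq: "cell_lattice \<D> = group_closure (cell_vec ` {a. cell a \<in> \<D>})"
  by (simp add: cell_lattice_def cell_vec_def image_Collect)

text \<open>Each lower left corner lies in the cell of the other and so dominates it coordinatewise.
  Cells can therefore be indexed by their lower left corners.\<close>

lemma inj_cell: "inj cell"
proof
  fix a b :: point assume eq: "cell a = cell b"
  have "a \<in> cell b" "b \<in> cell a" using eq by (auto simp: cell_def)
  then show "a = b" by (cases a; cases b) (auto simp: cell_def corner_defs)
qed

lemma cell_edges_cell:
  "cell_edges (cell a) = {{a, upper_corner a}, {upper_corner a, diag_corner a},
    {diag_corner a, right_corner a}, {a, right_corner a}}"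
  unfolding cell_edges_def inj_eq[OF inj_cell] by blast

section \<open>Subgroups generated by integer vectors\<close>

lemma frag_cmul_in_group_closure:
  assumes "x \<in> group_closure S"
  shows "frag_cmul k x \<in> group_closure S"
proof (induction k rule: int_induct[of _ 0])
  case (step1 i)
  then show ?case using assms by (simp add: frag_cmul_distrib group_closure_add)
next
  case (step2 i)
  then show ?case using assms by (simp add: frag_cmul_diff_distrib group_closure.diff)
qed simp

text \<open>The multiples of \<open>g\<close> collect into one coefficient: it is 1 for
  \<open>g\<close> itself, 0 for the other generators, and coefficients subtract under
  differences.\<close>

lemma group_closure_insert_decomp:
  fixes g :: "'v \<Rightarrow>\<^sub>0 int"
  assumes "x \<in> group_closure (insert g S)"
  shows "\<exists>k. x - frag_cmul k g \<in> group_closure S"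
  using assms
proof (induction rule: group_closure.induct)
  case (base s)
  then consider "s = g" | "s \<in> insert 0 S" by auto
  then show ?case
  proof cases
    case 1
    then show ?thesis by (intro exI[of _ 1]) simp
  next
    case 2
    then show ?thesis by (intro exI[of _ 0]) (simp add: group_closure.base)
  qed
next
  case (diff s t)
  then obtain k l where "s - frag_cmul k g \<in> group_closure S" "t - frag_cmul l g \<in> group_closure S"
    by blast
  then have "(s - frag_cmul k g) - (t - frag_cmul l g) \<in> group_closure S" by (rule group_closure.diff)
  then show ?case by (intro exI[of _ "k - l"]) (simp add: frag_cmul_diff_distrib algebra_simps)
qed

lemma group_closure_mono:
  assumes "x \<in> group_closure S" "S \<subseteq> T"
  shows "x \<in> group_closure T"
  using assms(1)
proof (induction rule: group_closure.induct)
  case (base s)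
  then show ?case using assms(2) by (intro group_closure.base) blast
qed (rule group_closure.diff)

text \<open>Taking a coordinate is additive, so its vanishing passes from the generators to the
  subgroup.\<close>

lemma lookup_group_closure_zero:
  assumes "x \<in> group_closure S" "\<And>s. s \<in> S \<Longrightarrow> Poly_Mapping.lookup s v = 0"
  shows "Poly_Mapping.lookup x v = (0 :: int)"
  using assms by (induction rule: group_closure.induct) (auto simp: lookup_minus)

text \<open>Order the cells by the level \<open>i + j\<close> of the lower left corner. The upper right corner of a
  cell of highest level lies in no other cell vector, so it serves as a pivot for eliminating the
  vector of that cell. Hence \<open>\<Phi>\<close> embeds the quotient of \<open>\<int>\<^bsup>\<int>\<^sup>2\<^esup>\<close> by the lattice into a
  free group.\<close>

lemma cell_lattice_kernel:
  assumes "finite A"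
  shows "\<exists>\<Phi> :: (point \<Rightarrow>\<^sub>0 int) \<Rightarrow> (point \<Rightarrow>\<^sub>0 int).
    (\<forall>x y. \<Phi> (x + y) = \<Phi> x + \<Phi> y) \<and> (\<forall>x. \<Phi> x = 0 \<longleftrightarrow> x \<in> group_closure (cell_vec ` A))"
  using assms
\<comment> \<open>Cells enter by nondecreasing level, so the new \<open>a\<close> has the highest
  level; the case that \<open>a\<close> already lies in \<open>A\<close> is split off.\<close>
proof (induction A rule: finite_ranking_induct[where f = "\<lambda>a. fst a + snd a"])
  case empty
  show ?case by (rule exI[of _ "\<lambda>x. x"]) simp
next
  case (insert a A)
  show ?case
  proof (cases "a \<in> A")
    case True
    then show ?thesis using insert.IH by (simp add: insert_absorb)
  next
    case False
    let ?G = "group_closure (cell_vec ` A)"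
    let ?b = "diag_corner a"
    obtain \<Phi> :: "(point \<Rightarrow>\<^sub>0 int) \<Rightarrow> (point \<Rightarrow>\<^sub>0 int)"
      where add: "\<And>x y. \<Phi> (x + y) = \<Phi> x + \<Phi> y" and ker: "\<And>x. \<Phi> x = 0 \<longleftrightarrow> x \<in> ?G"
      using insert.IH by blast
    have pivot: "Poly_Mapping.lookup (cell_vec a) ?b = 1"
      by (cases a) (simp add: cell_vec_def corner_defs lookup_add lookup_minus lookup_single)
    \<comment> \<open>The point \<open>?b\<close> is two levels above \<open>a\<close>. A cell of no
      higher level can reach it only with its diagonal corner, and then its lower left corner is
      \<open>a\<close>.\<close>
    have other: "Poly_Mapping.lookup s ?b = 0" if s: "s \<in> cell_vec ` A" for s
    proof -
      from s obtain y where y: "s = cell_vec y" "y \<in> A" by blast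
      have "fst y + snd y \<le> fst a + snd a" "y \<noteq> a" using insert.hyps y False by auto
      then show ?thesis unfolding y(1)
        by (cases a; cases y)
          (auto simp: cell_vec_def corner_defs lookup_add lookup_minus lookup_single when_def)
    qed
    \<comment> \<open>The subtraction clears the pivot coordinate along \<open>cell_vec a\<close>;
      then \<Phi> divides out the remaining cells.\<close>
    define \<Psi> where "\<Psi> x = \<Phi> (x - frag_cmul (Poly_Mapping.lookup x ?b) (cell_vec a))" for x
    have "\<Psi> (x + y) = \<Psi> x + \<Psi> y" for x y
      by (simp add: \<Psi>_def lookup_add frag_cmul_distrib algebra_simps flip: add)
    moreover have "\<Psi> x = 0 \<longleftrightarrow> x \<in> group_closure (cell_vec ` insert a A)" for x
    proof
      assume "\<Psi> x = 0"
      then have "x - frag_cmul (Poly_Mapping.lookup x ?b) (cell_vec a) \<in> ?G" by (simp add: \<Psi>_def ker)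
      then have "x - frag_cmul (Poly_Mapping.lookup x ?b) (cell_vec a) \<in> group_closure (cell_vec ` insert a A)"
        by (rule group_closure_mono) auto
      from group_closure_add[OF this frag_cmul_in_group_closure[OF group_closure.base]]
      show "x \<in> group_closure (cell_vec ` insert a A)"
        by (metis diff_add_cancel image_insert insertI1 insertI2)
    next
      assume "x \<in> group_closure (cell_vec ` insert a A)"
      then obtain k where k: "x - frag_cmul k (cell_vec a) \<in> ?G"
        using group_closure_insert_decomp by (metis image_insert)
      \<comment> \<open>All of \<open>?G\<close> vanishes at the pivot, so that coordinate of
        \<open>x\<close> forces \<open>k\<close> to be the multiple subtracted in \<Psi>.\<close>
      from lookup_group_closure_zero[OF this other] have "Poly_Mapping.lookup x ?b = k"
        by (simp add: lookup_minus pivot)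
      with k show "\<Psi> x = 0" by (simp add: \<Psi>_def ker)
    qed
    ultimately show ?thesis by blast
  qed
qed

lemma cell_lattice_keys: "e \<in> cell_lattice \<D> \<Longrightarrow> Poly_Mapping.keys e \<subseteq> vertices \<D>"
  unfolding cell_lattice_eq
proof (induction rule: group_closure.induct)
  case (base s)
  have "Poly_Mapping.keys (cell_vec a) \<subseteq> cell a" for a
    by (auto simp: cell_vec_def cell_def in_keys_iff lookup_add lookup_minus lookup_single when_def
        split: if_splits)
  with base show ?case by (fastforce simp: vertices_def)
next
  case (diff s t)
  then show ?case using keys_diff[of s t] by blast
qed

lemma keys_pos_part: "Poly_Mapping.keys (pos_part e) \<subseteq> Poly_Mapping.keys e"
  and keys_neg_part: "Poly_Mapping.keys (neg_part e) \<subseteq> Poly_Mapping.keys e"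
  by (auto simp: in_keys_iff lookup_pos_part lookup_neg_part)


section \<open>The ideals attached to an admissible set\<close>

definition cell_minor :: "point \<Rightarrow> (point, 'k::field) mpolynomial"
  where "cell_minor a = var a * var (diag_corner a) - var (upper_corner a) * var (right_corner a)"

lemma I_adj_eq: "I_adj \<C> = genideal (poly_ring (vertices \<C>)) (cell_minor ` {a. cell a \<in> \<C>})"
  by (simp add: I_adj_def cell_minor_def image_Collect)

lemma cell_subset_vertices: "cell a \<in> \<C> \<Longrightarrow> cell a \<subseteq> vertices \<C>"
  by (auto simp: vertices_def)

lemma cell_minor_in_poly_ring: "cell a \<in> \<C> \<Longrightarrow> cell_minor a \<in> carrier (poly_ring (vertices \<C>))"
  using cell_subset_vertices[of a \<C>]
  by (auto simp: cell_minor_def cell_def intro!: poly_ring_diff poly_ring_mult)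

lemma cell_minor_in_I_adj:
  assumes "cell a \<in> \<C>"
  shows "cell_minor a \<in> (I_adj \<C> :: (point, 'k::field) mpolynomial set)"
proof -
  interpret cring "poly_ring (vertices \<C>) :: (point, 'k) mpolynomial ring" by (rule cring_poly_ring)
  show ?thesis unfolding I_adj_eq
    using assms by (intro subsetD[OF genideal_self]) (auto intro: cell_minor_in_poly_ring)
qed

text \<open>This links minors to the lattice: by \<open>cell_minor_eq\<close>, the same two exponent
  vectors occur in the adjacent minor at \<open>a\<close>.\<close>

lemma cell_vec_eq:
  "cell_vec a = int_vec (Poly_Mapping.single a 1 + Poly_Mapping.single (diag_corner a) 1)
    - int_vec (Poly_Mapping.single (upper_corner a) 1 + Poly_Mapping.single (right_corner a) 1)"
  by (simp add: cell_vec_def int_vec_add)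

lemma cell_minor_eq:
  "cell_minor a = monomial (Poly_Mapping.single a 1 + Poly_Mapping.single (diag_corner a) 1)
    - monomial (Poly_Mapping.single (upper_corner a) 1 + Poly_Mapping.single (right_corner a) 1)"
  by (simp add: cell_minor_def var_def monomial_add)

section \<open>Primes containing the adjacent minors\<close>

text \<open>Modulo the minor, the product of the diagonal variables lies in \<open>P\<close> iff
  that of the anti-diagonal ones does. By primality the set meets one diagonal iff it meets the
  other, and a diagonal and an anti-diagonal corner always span an edge.\<close>

lemma admissible_vars_of_prime:
  fixes P :: "(point, 'k::field) mpolynomial set"
  assumes P: "primeideal P (poly_ring (vertices \<C>))" and I: "I_adj \<C> \<subseteq> P"
    and cells: "\<And>C. C \<in> \<C> \<Longrightarrow> is_cell C"
  shows "admissible \<C> {v \<in> vertices \<C>. var v \<in> P}"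
  unfolding admissible_def
proof (intro conjI ballI)
  interpret primeideal P "poly_ring (vertices \<C>)" by (rule P)
  have id: "ideal P (poly_ring (vertices \<C>))" by (rule is_ideal)
  fix C assume "C \<in> \<C>"
  with cells obtain a where C: "C = cell a" unfolding is_cell_def by blast
  let ?b = "diag_corner a" and ?c = "upper_corner a" and ?d = "right_corner a"
  have V: "a \<in> vertices \<C>" "?b \<in> vertices \<C>" "?c \<in> vertices \<C>" "?d \<in> vertices \<C>"
    using \<open>C \<in> \<C>\<close> cell_subset_vertices[of a \<C>] by (auto simp: C cell_def)
  have min: "cell_minor a \<in> P" using I cell_minor_in_I_adj \<open>C \<in> \<C>\<close> C by blast
  have prime: "var u * var v \<in> P \<longleftrightarrow> var u \<in> P \<or> var v \<in> P" if "u \<in> vertices \<C>" "v \<in> vertices \<C>" for u v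
    using that I_prime[of "var u" "var v"] I_l_closed[of "var v" "var u"] I_r_closed[of "var u" "var v"] by auto
  have "var a * var ?b \<in> P \<longleftrightarrow> var ?c * var ?d \<in> P"
    using poly_ring_ideal_diff[OF id _ min, of "var a * var ?b"]
      poly_ring_ideal_add[OF id _ min, of "var ?c * var ?d"]
    by (auto simp: cell_minor_def)
  then have key: "var a \<in> P \<or> var ?b \<in> P \<longleftrightarrow> var ?c \<in> P \<or> var ?d \<in> P"
    using prime V by simp
  have edges: "{a, ?c} \<in> cell_edges C" "{?c, ?b} \<in> cell_edges C" "{?b, ?d} \<in> cell_edges C"
    "{a, ?d} \<in> cell_edges C"
    unfolding C cell_edges_cell by blast+
  let ?W = "{v \<in> vertices \<C>. var v \<in> P}"
  show "?W \<inter> C = {} \<or> (\<exists>e\<in>cell_edges C. e \<subseteq> ?W \<inter> C)"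
  proof (rule disjCI)
    assume "\<not> (\<exists>e\<in>cell_edges C. e \<subseteq> ?W \<inter> C)"
    then have "\<not> {a, ?c} \<subseteq> ?W \<inter> C" "\<not> {?c, ?b} \<subseteq> ?W \<inter> C" "\<not> {?b, ?d} \<subseteq> ?W \<inter> C" "\<not> {a, ?d} \<subseteq> ?W \<inter> C"
      using edges by blast+
    then show "?W \<inter> C = {}" using key V by (auto simp: C cell_def)
  qed
qed auto

text \<open>Differences of lattice vectors correspond to cross-multiplied binomials, up to a common
  monomial factor. That factor involves only variables outside the prime, so it cancels at the
  end.\<close>

lemma lattice_binomial_in_prime:
  fixes P :: "(point, 'k::field) mpolynomial set"
  assumes P: "primeideal P (poly_ring V)" and V: "vertices \<D> \<subseteq> V"
    and vars: "\<And>v. v \<in> vertices \<D> \<Longrightarrow> var v \<notin> P"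
    and minors: "\<And>a. cell a \<in> \<D> \<Longrightarrow> cell_minor a \<in> P"
    and e: "e \<in> cell_lattice \<D>"
  shows "monomial (pos_part e) - monomial (neg_part e) \<in> P"
proof -
  interpret primeideal P "poly_ring V" by (rule P)
  have id: "ideal P (poly_ring V)" by (rule is_ideal)
  \<comment> \<open>The induction allows any \<open>m\<close> and \<open>n\<close> with difference
    \<open>e\<close>, since cross-multiplication need not produce the positive and negative
    parts.\<close>
  have "\<exists>m n. Poly_Mapping.keys m \<subseteq> vertices \<D> \<and> Poly_Mapping.keys n \<subseteq> vertices \<D> \<and>
    int_vec m - int_vec n = e \<and> monomial m - monomial n \<in> P"
    using e unfolding cell_lattice_eq
  proof (induction rule: group_closure.induct)
    case (base s)
    then consider "s = 0" | a where "s = cell_vec a" "cell a \<in> \<D>" by auto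
    then show ?case
    proof cases
      case 1
      then show ?thesis using id by (intro exI[of _ 0]) (auto simp: poly_ring_ideal_zero)
    next
      case 2
      then have "cell a \<subseteq> vertices \<D>" by (simp add: cell_subset_vertices)
      with 2 show ?thesis using minors[OF 2(2)]
        by (intro exI conjI, unfold cell_vec_eq cell_minor_eq) (auto simp: keys_add_nat cell_def)
    qed
  next
    case (diff s t)
    then obtain m n m' n' where *:
      "Poly_Mapping.keys m \<subseteq> vertices \<D>" "Poly_Mapping.keys n \<subseteq> vertices \<D>"
      "int_vec m - int_vec n = s" "monomial m - monomial n \<in> P"
      "Poly_Mapping.keys m' \<subseteq> vertices \<D>" "Poly_Mapping.keys n' \<subseteq> vertices \<D>"
      "int_vec m' - int_vec n' = t" "monomial m' - monomial n' \<in> P"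
      by blast
    \<comment> \<open>The terms x^(n+n') cancel, leaving a binomial with exponent difference
      \<open>s - t\<close>.\<close>
    have "monomial n' * (monomial m - monomial n) - monomial n * (monomial m' - monomial n') \<in> P"
      using * V
      by (intro poly_ring_ideal_diff[OF id poly_ring_ideal_mult[OF id] poly_ring_ideal_mult[OF id]]) auto
    then have "monomial (m + n') - monomial (n + m') \<in> P"
      by (simp add: monomial_add algebra_simps)
    moreover have "int_vec (m + n') - int_vec (n + m') = s - t"
      using *(3,7) by (simp add: int_vec_add algebra_simps flip: *(3,7))
    ultimately show ?case using *
      by (intro exI[of _ "m + n'"] exI[of _ "n + m'"]) (auto simp: keys_add_nat)
  qed
  then obtain m n where mn: "Poly_Mapping.keys m \<subseteq> vertices \<D>" "int_vec m - int_vec n = e"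
    "monomial m - monomial n \<in> P" by blast
  from int_vec_diff_decomp[OF mn(2)] obtain r where r: "m = pos_part e + r" "n = neg_part e + r" .
  have "Poly_Mapping.keys r \<subseteq> vertices \<D>" using mn(1) r(1) by (simp add: keys_add_nat)
  then have "monomial r \<notin> P" using V vars by (intro monomial_notin_prime[OF P]) auto
  moreover have "monomial r * (monomial (pos_part e) - monomial (neg_part e)) \<in> P"
    using mn(3) by (simp add: r monomial_add algebra_simps)
  moreover have "monomial (pos_part e) - monomial (neg_part e) \<in> carrier (poly_ring V)"
    using keys_pos_part[of e] keys_neg_part[of e] cell_lattice_keys[OF e] V
    by (intro poly_ring_diff) auto
  ultimately show ?thesis
    using I_prime[of "monomial r" "monomial (pos_part e) - monomial (neg_part e)"]
      \<open>Poly_Mapping.keys r \<subseteq> vertices \<D>\<close> V by auto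
qed

section \<open>Generation and primality of the ideals P_W\<close>

lemma vertices_cells_avoiding: "vertices (cells_avoiding \<C> W) \<subseteq> vertices \<C> - W"
  by (auto simp: vertices_def cells_avoiding_def)

lemma lattice_gens_in_poly_ring:
  "{monomial (pos_part e) - monomial (neg_part e) |e. e \<in> cell_lattice (cells_avoiding \<C> W)}
    \<subseteq> carrier (poly_ring (vertices \<C>))"
proof safe
  fix e assume "e \<in> cell_lattice (cells_avoiding \<C> W)"
  then have "Poly_Mapping.keys e \<subseteq> vertices \<C>"
    using cell_lattice_keys vertices_cells_avoiding by fast
  then show "monomial (pos_part e) - monomial (neg_part e) \<in> carrier (poly_ring (vertices \<C>))"
    using keys_pos_part[of e] keys_neg_part[of e] by (intro poly_ring_diff) auto
qed

text \<open>A sum of ideals is generated by their union; in this form \<open>genideal_self\<close>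
  and \<open>genideal_minimal\<close> apply.\<close>

lemma P_ideal_eq:
  assumes "W \<subseteq> vertices \<C>"
  shows "P_ideal \<C> W = genideal (poly_ring (vertices \<C>))
    (genideal (poly_ring (vertices \<C>)) (var ` W) \<union> lattice_ideal \<C> (cells_avoiding \<C> W)
      :: (point, 'k::field) mpolynomial set)"
proof -
  interpret cring "poly_ring (vertices \<C>) :: (point, 'k) mpolynomial ring" by (rule cring_poly_ring)
  show ?thesis unfolding P_ideal_def lattice_ideal_def
    using assms
    by (intro union_genideal[symmetric] genideal_ideal lattice_gens_in_poly_ring) auto
qed

text \<open>These facts characterise P_W as the smallest ideal containing the variables of
  \<open>W\<close> and the lattice binomials. The later arguments rest on them instead of the
  definition.\<close>

lemma
  assumes W: "W \<subseteq> vertices \<C>"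
  shows ideal_P_ideal: "ideal (P_ideal \<C> W :: (point, 'k::field) mpolynomial set) (poly_ring (vertices \<C>))"
    and var_in_P_ideal: "w \<in> W \<Longrightarrow> var w \<in> (P_ideal \<C> W :: (point, 'k) mpolynomial set)"
    and lattice_binomial_in_P_ideal: "e \<in> cell_lattice (cells_avoiding \<C> W) \<Longrightarrow>
      monomial (pos_part e) - monomial (neg_part e) \<in> (P_ideal \<C> W :: (point, 'k) mpolynomial set)"
    and P_ideal_minimal: "\<And>J. ideal (J :: (point, 'k) mpolynomial set) (poly_ring (vertices \<C>)) \<Longrightarrow>
      var ` W \<subseteq> J \<Longrightarrow>
      (\<And>e. e \<in> cell_lattice (cells_avoiding \<C> W) \<Longrightarrow> monomial (pos_part e) - monomial (neg_part e) \<in> J) \<Longrightarrow>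
      P_ideal \<C> W \<subseteq> J"
proof -
  interpret cring "poly_ring (vertices \<C>) :: (point, 'k) mpolynomial ring" by (rule cring_poly_ring)
  let ?L = "lattice_ideal \<C> (cells_avoiding \<C> W) :: (point, 'k) mpolynomial set"
  let ?X = "genideal (poly_ring (vertices \<C>)) (var ` W) :: (point, 'k) mpolynomial set"
  let ?G = "{monomial (pos_part e) - monomial (neg_part e) |e. e \<in> cell_lattice (cells_avoiding \<C> W)}
    :: (point, 'k) mpolynomial set"
  have var: "var ` W \<subseteq> carrier (poly_ring (vertices \<C>) :: (point, 'k) mpolynomial ring)" using W by auto
  have gens: "?G \<subseteq> carrier (poly_ring (vertices \<C>))" by (rule lattice_gens_in_poly_ring)
  have L: "ideal ?L (poly_ring (vertices \<C>))" "?G \<subseteq> ?L"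
    unfolding lattice_ideal_def by (intro genideal_ideal genideal_self gens)+
  have X: "ideal ?X (poly_ring (vertices \<C>))" "var ` W \<subseteq> ?X"
    by (intro genideal_ideal genideal_self var)+
  have sub: "?X \<union> ?L \<subseteq> carrier (poly_ring (vertices \<C>))"
    using ideal.Icarr[OF X(1)] ideal.Icarr[OF L(1)] by blast
  show "ideal (P_ideal \<C> W :: (point, 'k) mpolynomial set) (poly_ring (vertices \<C>))"
    unfolding P_ideal_eq[OF W] by (rule genideal_ideal[OF sub])
  have P: "?X \<union> ?L \<subseteq> P_ideal \<C> W" unfolding P_ideal_eq[OF W] by (rule genideal_self[OF sub])
  show "w \<in> W \<Longrightarrow> var w \<in> (P_ideal \<C> W :: (point, 'k) mpolynomial set)"
    using P X(2) by blast
  show "e \<in> cell_lattice (cells_avoiding \<C> W) \<Longrightarrow>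
      monomial (pos_part e) - monomial (neg_part e) \<in> (P_ideal \<C> W :: (point, 'k) mpolynomial set)"
    using P L(2) by blast
  fix J :: "(point, 'k) mpolynomial set"
  assume J: "ideal J (poly_ring (vertices \<C>))" "var ` W \<subseteq> J"
    "\<And>e. e \<in> cell_lattice (cells_avoiding \<C> W) \<Longrightarrow> monomial (pos_part e) - monomial (neg_part e) \<in> J"
  have "?X \<subseteq> J" using J by (intro genideal_minimal)
  moreover have "?L \<subseteq> J" unfolding lattice_ideal_def using J by (intro genideal_minimal) auto
  ultimately show "P_ideal \<C> W \<subseteq> J" unfolding P_ideal_eq[OF W] using J by (intro genideal_minimal) auto
qed

text \<open>P_W is the kernel of the toric map that kills \<open>W\<close> and identifies monomials
  whose exponents differ by a lattice vector; \<open>cell_lattice_kernel\<close> supplies the map on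
  exponents.\<close>

lemma primeideal_P_ideal:
  assumes fin: "finite \<C>" and W: "W \<subseteq> vertices \<C>"
  shows "primeideal (P_ideal \<C> W :: (point, 'k::field) mpolynomial set) (poly_ring (vertices \<C>))"
proof -
  let ?V = "vertices \<C>" and ?D = "cells_avoiding \<C> W"
  let ?P = "P_ideal \<C> W :: (point, 'k) mpolynomial set"
  have "{a. cell a \<in> ?D} \<subseteq> cell -` \<C>" by (auto simp: cells_avoiding_def)
  then have "finite {a. cell a \<in> ?D}"
    by (rule finite_subset) (simp add: finite_vimageI fin inj_cell)
  then obtain \<Phi> :: "(point \<Rightarrow>\<^sub>0 int) \<Rightarrow> (point \<Rightarrow>\<^sub>0 int)"
    where add: "\<And>x y. \<Phi> (x + y) = \<Phi> x + \<Phi> y" and ker: "\<And>x. \<Phi> x = 0 \<longleftrightarrow> x \<in> cell_lattice ?D"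
    using cell_lattice_kernel unfolding cell_lattice_eq by blast
  have eq_iff: "\<Phi> x = \<Phi> y \<longleftrightarrow> x - y \<in> cell_lattice ?D" for x y
    using add[of "x - y" y] ker[of "x - y"] by simp
  define \<phi> where "\<phi> m = \<Phi> (int_vec m)" for m
  have phi_add: "\<phi> (m + n) = \<phi> m + \<phi> n" for m n by (simp add: \<phi>_def int_vec_add add)
  let ?K = "{f \<in> carrier (poly_ring ?V). toric_hom W \<phi> f = (0 :: _ \<Rightarrow>\<^sub>0 'k)}"
  \<comment> \<open>Here \<open>'g\<close> consists of integer vectors indexed by points; the
    lexicographic order on points provides the linear order required of it.\<close>
  have K: "primeideal ?K (poly_ring ?V)" by (rule primeideal_toric_hom_kernel[OF phi_add])
  have "?P \<subseteq> ?K"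
  proof (rule P_ideal_minimal[OF W])
    show "ideal ?K (poly_ring ?V)" using K by (rule primeideal.axioms(1))
    show "var ` W \<subseteq> ?K" using W by (auto simp: var_def monomial_def toric_hom_single)
    fix e assume e: "e \<in> cell_lattice ?D"
    have "\<phi> (pos_part e) = \<phi> (neg_part e)"
      by (simp add: \<phi>_def eq_iff int_vec_pos_part_diff_neg_part e)
    moreover have "Poly_Mapping.keys e \<inter> W = {}" "Poly_Mapping.keys e \<subseteq> ?V"
      using cell_lattice_keys[OF e] vertices_cells_avoiding[of \<C> W] by auto
    then have "Poly_Mapping.keys (pos_part e) \<inter> W = {}" "Poly_Mapping.keys (neg_part e) \<inter> W = {}"
      "Poly_Mapping.keys (pos_part e) \<subseteq> ?V" "Poly_Mapping.keys (neg_part e) \<subseteq> ?V"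
      using keys_pos_part[of e] keys_neg_part[of e] by auto
    ultimately show "monomial (pos_part e) - monomial (neg_part e) \<in> ?K"
      by (simp add: poly_ring_diff) (simp add: toric_hom_diff toric_hom_single monomial_def)
  qed
  moreover have "?K \<subseteq> ?P"
  proof
    fix f assume f: "f \<in> ?K"
    show "f \<in> ?P"
    proof (rule toric_hom_kernel_subset[OF ideal_P_ideal[OF W] var_in_P_ideal[OF W]])
      fix m n :: "point \<Rightarrow>\<^sub>0 nat"
      assume mn: "Poly_Mapping.keys m \<subseteq> ?V" "Poly_Mapping.keys n \<subseteq> ?V" "\<phi> m = \<phi> n"
      define e where "e = int_vec m - int_vec n"
      have e: "e \<in> cell_lattice ?D" using mn(3) by (simp add: \<phi>_def eq_iff e_def)
      \<comment> \<open>The exponents differ by a lattice vector, so the binomial is x^r times a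
        generator of the lattice ideal.\<close>
      from int_vec_diff_decomp[OF e_def[symmetric]]
      obtain r where r: "m = pos_part e + r" "n = neg_part e + r" .
      have "Poly_Mapping.keys r \<subseteq> ?V" using mn(1) r(1) by (simp add: keys_add_nat)
      then have "monomial r * (monomial (pos_part e) - monomial (neg_part e)) \<in> ?P"
        using lattice_binomial_in_P_ideal[OF W e]
        by (intro poly_ring_ideal_mult[OF ideal_P_ideal[OF W]]) auto
      then show "monomial m - monomial n \<in> ?P" by (simp add: r monomial_add algebra_simps)
    qed (use f in auto)
  qed
  ultimately have "?P = ?K" by (rule subset_antisym)
  with K show ?thesis by simp
qed

text \<open>For a cell avoiding \<open>W\<close> the minor is a multiple of a lattice binomial.
  Otherwise \<open>W\<close> contains an edge, hence a diagonal and an anti-diagonal corner, and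
  both terms of the minor lie in P_W.\<close>

lemma I_adj_subset_P_ideal:
  assumes adm: "admissible \<C> W"
  shows "I_adj \<C> \<subseteq> (P_ideal \<C> W :: (point, 'k::field) mpolynomial set)"
proof -
  interpret cring "poly_ring (vertices \<C>) :: (point, 'k) mpolynomial ring" by (rule cring_poly_ring)
  let ?P = "P_ideal \<C> W :: (point, 'k) mpolynomial set"
  have W: "W \<subseteq> vertices \<C>" using adm by (simp add: admissible_def)
  note id = ideal_P_ideal[OF W, where 'k = 'k]
  show ?thesis unfolding I_adj_eq
  proof (rule genideal_minimal[OF id], rule image_subsetI, unfold mem_Collect_eq)
    fix a assume a: "cell a \<in> \<C>"
    let ?b = "diag_corner a" and ?c = "upper_corner a" and ?d = "right_corner a"
    have V: "a \<in> vertices \<C>" "?b \<in> vertices \<C>" "?c \<in> vertices \<C>" "?d \<in> vertices \<C>"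
      using cell_subset_vertices[OF a] by (auto simp: cell_def)
    show "cell_minor a \<in> ?P"
    proof (cases "W \<inter> cell a = {}")
      case True
      let ?m = "Poly_Mapping.single a 1 + Poly_Mapping.single ?b (1::nat)"
      let ?n = "Poly_Mapping.single ?c 1 + Poly_Mapping.single ?d (1::nat)"
      have e: "cell_vec a \<in> cell_lattice (cells_avoiding \<C> W)"
        using True a unfolding cell_lattice_eq
        by (intro group_closure.base) (auto simp: cells_avoiding_def)
      \<comment> \<open>Allowing a common factor x^r avoids computing the two parts of
        \<open>cell_vec a\<close>.\<close>
      from int_vec_diff_decomp[OF cell_vec_eq[symmetric]]
      obtain r where r: "?m = pos_part (cell_vec a) + r" "?n = neg_part (cell_vec a) + r" .
      have "Poly_Mapping.keys r \<subseteq> Poly_Mapping.keys ?m" by (simp only: r(1) keys_add_nat) simp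
      then have "Poly_Mapping.keys r \<subseteq> vertices \<C>" using V by (auto simp: keys_add_nat)
      then have "monomial r * (monomial (pos_part (cell_vec a)) - monomial (neg_part (cell_vec a))) \<in> ?P"
        using lattice_binomial_in_P_ideal[OF W e] by (intro poly_ring_ideal_mult[OF id]) auto
      then show ?thesis unfolding cell_minor_eq r by (simp add: monomial_add algebra_simps)
    next
      case False
      with bspec[OF conjunct2[OF adm[unfolded admissible_def]] a]
      obtain e where "e \<in> cell_edges (cell a)" "e \<subseteq> W" by blast
      then have "(a \<in> W \<or> ?b \<in> W) \<and> (?c \<in> W \<or> ?d \<in> W)"
        unfolding cell_edges_cell by blast
      moreover have "var u * var v \<in> ?P" if "u \<in> W \<or> v \<in> W" "u \<in> vertices \<C>" "v \<in> vertices \<C>" for u v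
        using that poly_ring_ideal_mult[OF id var_in_P_ideal[OF W], of u "var v"]
          poly_ring_ideal_mult[OF id var_in_P_ideal[OF W], of v "var u"]
        by (auto simp: mult.commute)
      ultimately show ?thesis unfolding cell_minor_def using V
        by (intro poly_ring_ideal_diff[OF id]) auto
    qed
  qed
qed

theorem theorem2p6:
  fixes \<C> :: "point set set" and \<pp> :: "(point, 'k::field) mpolynomial set"
  assumes "\<And>C. C \<in> \<C> \<Longrightarrow> is_cell C"
    and "finite \<C>" and "\<C> \<noteq> {}" and "weakly_connected \<C>"
    and "minimal_prime_over (poly_ring (vertices \<C>)) (I_adj \<C>) \<pp>"
  shows "\<exists>W. admissible \<C> W \<and> \<pp> = P_ideal \<C> W"
proof -
  have prime: "primeideal \<pp> (poly_ring (vertices \<C>))" and I: "I_adj \<C> \<subseteq> \<pp>"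
    and minimal: "\<And>Q. primeideal Q (poly_ring (vertices \<C>)) \<Longrightarrow> I_adj \<C> \<subseteq> Q \<Longrightarrow> Q \<subseteq> \<pp> \<Longrightarrow> Q = \<pp>"
    using assms(5) by (auto simp: minimal_prime_over_def)
  define W where "W = {v \<in> vertices \<C>. var v \<in> \<pp>}"
  have adm: "admissible \<C> W"
    unfolding W_def using prime I assms(1) by (rule admissible_vars_of_prime)
  have W: "W \<subseteq> vertices \<C>" by (auto simp: W_def)
  have minors: "cell_minor a \<in> \<pp>" if "cell a \<in> \<C>" for a
    using cell_minor_in_I_adj[OF that] I by blast
  have "P_ideal \<C> W \<subseteq> \<pp>"
  proof (rule P_ideal_minimal[OF W primeideal.axioms(1)[OF prime]])
    fix e assume "e \<in> cell_lattice (cells_avoiding \<C> W)"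
    \<comment> \<open>A vertex of a cell avoiding \<open>W\<close> is not in \<open>W\<close>, so
      its variable lies outside \<pp> and the cancellation in
      \<open>lattice_binomial_in_prime\<close> is available.\<close>
    then show "monomial (pos_part e) - monomial (neg_part e) \<in> \<pp>"
      using vertices_cells_avoiding[of \<C> W]
      by (intro lattice_binomial_in_prime[OF prime])
        (auto simp: W_def cells_avoiding_def intro: minors)
  qed (auto simp: W_def)
  then have "P_ideal \<C> W = \<pp>"
    using primeideal_P_ideal[OF assms(2) W] I_adj_subset_P_ideal[OF adm] by (intro minimal)
  with adm show ?thesis by blast
qed

end
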